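(* Reduce-Fastest$(1)$ does not achieve any backlog less than $3$: for every $c < 3$ there exist $n \in \mathbb{N}$ and growth rates $h_1,\dots,h_n > 0$ with $\sum_i h_i \le 1$ such that, in the bamboo trimming process run with Reduce-Fastest$(1)$, some bamboo reaches height greater than $c$.
   Context: Bamboo trimming problem: bamboo $b_1,\dots,b_n$ with growth rates $h_i>0$, all starting at height $0$; each time step consists of every $b_i$ growing by $h_i$, after which the algorithm cuts at most one bamboo to height $0$. Reduce-Fastest$(x)$: after the growth phase of each step, among bamboo with height at least $x$, cut one with the largest growth rate (ties broken arbitrarily); if none has height at least $x$, cut nothing. The backlog is the maximum height ever reached by any bamboo, including immediately after growth and before the cut. *)

theory Defs
  imports Complex_Main
begin

text \<open>
  Bamboos are indexed by 1, ..., n, and h i is the growth rate of bamboo i.  A sequence of cuts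
  is a function cuts, where cuts t is the bamboo that is cut at the end of the t-th time step
  (steps are numbered from 0), or None if nothing is cut in that step.
\<close>

primrec height :: "(nat \<Rightarrow> real) \<Rightarrow> (nat \<Rightarrow> nat option) \<Rightarrow> nat \<Rightarrow> nat \<Rightarrow> real" where
  "height h cuts 0 = (\<lambda>i. 0)"
| "height h cuts (Suc t) = (\<lambda>i. if cuts t = Some i then 0 else height h cuts t i + h i)"

text \<open>
  The height in step t after the growth phase and before the cut.  The heights a bamboo ever has
  are the initial height 0, these heights, and the heights after a cut, which for positive growth
  rates never exceed them.
\<close>

definition grown_height :: "(nat \<Rightarrow> real) \<Rightarrow> (nat \<Rightarrow> nat option) \<Rightarrow> nat \<Rightarrow> nat \<Rightarrow> real" where
  "grown_height h cuts t i = height h cuts t i + h i"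

text \<open>
  The cuts are those of a run of Reduce-Fastest(x).  This is a predicate and not a function
  because ties between bamboos of equal growth rate may be broken in any way, possibly
  differently in different steps.
\<close>

definition reduce_fastest ::
  "real \<Rightarrow> nat \<Rightarrow> (nat \<Rightarrow> real) \<Rightarrow> (nat \<Rightarrow> nat option) \<Rightarrow> bool" where
  "reduce_fastest x n h cuts \<longleftrightarrow>
     (\<forall>t. case cuts t of
            None \<Rightarrow> \<forall>i\<in>{1..n}. grown_height h cuts t i < x
          | Some j \<Rightarrow> j \<in> {1..n} \<and> grown_height h cuts t j \<ge> x \<and>
                      (\<forall>i\<in>{1..n}. grown_height h cuts t i \<ge> x \<longrightarrow> h i \<le> h j))"

text \<open>Runs exist for all parameters, so quantifying over all runs is never vacuous.\<close>

lemma reduce_fastest_exists: "\<exists>cuts. reduce_fastest x n h cuts"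
proof -
  define ok where "ok g c \<longleftrightarrow>
     (case c of None \<Rightarrow> \<forall>i\<in>{1..n}. g i < x
      | Some j \<Rightarrow> j \<in> {1..n} \<and> g j \<ge> x \<and> (\<forall>i\<in>{1..n}. g i \<ge> x \<longrightarrow> h i \<le> h j))"
    for g :: "nat \<Rightarrow> real" and c
  have "\<exists>c. ok g c" for g
  proof (cases "\<exists>i\<in>{1..n}. g i \<ge> x")
    case False
    then have "ok g None"
      by (auto simp: ok_def not_le)
    then show ?thesis ..
  next
    case True
    let ?S = "{i\<in>{1..n}. g i \<ge> x}"
    have S: "finite ?S" "?S \<noteq> {}"
      using True by auto
    then have "Max (h ` ?S) \<in> h ` ?S"
      by (intro Max_in) auto
    then obtain j where j: "j \<in> ?S" "h j = Max (h ` ?S)"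
      by auto
    then have "\<forall>i\<in>?S. h i \<le> h j"
      using S by simp
    then have "ok g (Some j)"
      using j by (auto simp: ok_def)
    then show ?thesis ..
  qed
  then obtain pick where pick: "ok g (pick g)" for g
    by metis
  define H where "H = rec_nat (\<lambda>i. 0)
     (\<lambda>_ f i. if pick (\<lambda>i. f i + h i) = Some i then 0 else f i + h i)"
  define cuts where "cuts t = pick (\<lambda>i. H t i + h i)" for t
  have H_0: "H 0 = (\<lambda>i. 0)"
    and H_Suc: "H (Suc t) = (\<lambda>i. if cuts t = Some i then 0 else H t i + h i)" for t
    unfolding cuts_def H_def by simp_all
  have "height h cuts t = H t" for t
    by (induction t) (auto simp: H_0 H_Suc fun_eq_iff)
  then have "grown_height h cuts t = (\<lambda>i. H t i + h i)" for t
    by (simp add: grown_height_def fun_eq_iff)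
  then have "ok (grown_height h cuts t) (cuts t)" for t
    using pick by (simp add: cuts_def)
  then have "reduce_fastest x n h cuts"
    by (simp add: reduce_fastest_def ok_def)
  then show ?thesis by blast
qed

end

theory Submission
  imports Defs
begin

text \<open>
  All rates are reciprocals of integers.  Take \<open>P - 200\<close> slow bamboos of period \<open>P = 600 N\<close>, and
  one last bamboo of period \<open>P + 1\<close>.  A slow bamboo that is not ready has been cut within the
  last \<open>P - 1\<close> steps, so as long as at least \<open>200\<close> of any \<open>P - 1\<close> consecutive steps are spent on
  faster bamboos, some slow one is always ready and the last bamboo is never cut.

  The faster bamboos form 50 triples with periods just below \<open>2P/3\<close> and equal to \<open>0.775 P\<close> and
  \<open>0.845 P\<close>.  The total rate of a triple is about \<open>3.974 / P\<close>, which in the long run is too small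
  for 4 cuts in \<open>P\<close> steps; but since all bamboos start at height 0, every window of
  length \<open>P\<close> that starts between \<open>P\<close> and almost \<open>2P\<close> does contain 4 cuts of each triple.  The
  missing \<open>0.026\<close> per triple pays for the last bamboo, which therefore survives until almost
  \<open>3P\<close>.  Delays among the faster bamboos are bounded independently of \<open>N\<close> and negligible.
\<close>

section \<open>Ages and cut counts for an arbitrary sequence of cuts\<close>

text \<open>Integer stand-in for height: with rate \<open>1 / p\<close> the height is
  \<open>age / p\<close>, so being ready for a cut becomes \<open>p \<le> Suc age\<close>.\<close>

primrec age :: "(nat \<Rightarrow> nat option) \<Rightarrow> nat \<Rightarrow> nat \<Rightarrow> nat" where
  "age cuts i 0 = 0"
| "age cuts i (Suc t) = (if cuts t = Some i then 0 else Suc (age cuts i t))"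

definition cuts_in :: "(nat \<Rightarrow> nat option) \<Rightarrow> nat \<Rightarrow> nat set \<Rightarrow> nat set" where
  "cuts_in cuts i T = {s \<in> T. cuts s = Some i}"

lemma age_le: "age cuts i t \<le> t"
  by (induction t) auto

lemma age_add_le:
  "age cuts i (t + d) \<le> age cuts i t + d"
  by (induction d) auto

lemma age_uncut:
  assumes "d < age cuts i t"
  shows "cuts (t - Suc d) \<noteq> Some i" "age cuts i (t - Suc d) = age cuts i t - Suc d"
proof -
  have "cuts (t - Suc d) \<noteq> Some i \<and> age cuts i (t - Suc d) = age cuts i t - Suc d"
    using assms
  proof (induction t arbitrary: d)
    case 0
    then show ?case by simp
  next
    case (Suc t)
    then have nc: "cuts t \<noteq> Some i" and a: "age cuts i (Suc t) = Suc (age cuts i t)"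
      by (auto split: if_splits)
    show ?case
      using Suc.IH[of "d - 1"] Suc.prems a nc by (cases d) auto
  qed
  then show "cuts (t - Suc d) \<noteq> Some i" "age cuts i (t - Suc d) = age cuts i t - Suc d"
    by auto
qed

lemma age_after_cut:
  assumes "cuts s = Some i" "s < t"
  shows "age cuts i t \<le> t - Suc s"
proof -
  have "age cuts i (Suc s + (t - Suc s)) \<le> age cuts i (Suc s) + (t - Suc s)"
    by (rule age_add_le)
  then show ?thesis
    using assms by simp
qed

lemma recent_cut:
  assumes "age cuts i t < t"
  shows "\<exists>s<t. cuts s = Some i \<and> age cuts i t = t - Suc s"
  using assms
proof (induction t)
  case 0
  then show ?case by simp
next
  case (Suc t)
  show ?case
  proof (cases "cuts t = Some i")
    case True
    then show ?thesis by auto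
  next
    case False
    then have "age cuts i t < t"
      using Suc.prems by simp
    then obtain s where "s < t" "cuts s = Some i" "age cuts i t = t - Suc s"
      using Suc.IH by blast
    then show ?thesis
      using False by (intro exI[of _ s]) auto
  qed
qed

lemma card_cuts_in_Suc:
  "card (cuts_in cuts i {..<Suc t}) =
     (if cuts t = Some i then Suc (card (cuts_in cuts i {..<t})) else card (cuts_in cuts i {..<t}))"
proof -
  have "cuts_in cuts i {..<Suc t} =
     (if cuts t = Some i then insert t (cuts_in cuts i {..<t}) else cuts_in cuts i {..<t})"
    by (auto simp: cuts_in_def less_Suc_eq)
  then show ?thesis
    by (auto simp: cuts_in_def)
qed

lemma card_cuts_in_window:
  assumes "w \<le> t"
  shows "card (cuts_in cuts i {w..<t}) =
    card (cuts_in cuts i {..<t}) - card (cuts_in cuts i {..<w})"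
proof -
  have "cuts_in cuts i {w..<t} = cuts_in cuts i {..<t} - cuts_in cuts i {..<w}"
    by (auto simp: cuts_in_def)
  moreover have "cuts_in cuts i {..<w} \<subseteq> cuts_in cuts i {..<t}"
    using assms by (auto simp: cuts_in_def)
  ultimately show ?thesis
    by (simp add: card_Diff_subset cuts_in_def)
qed

lemma sum_card_cuts_in_le:
  assumes "finite T" "finite A"
  shows "(\<Sum>i\<in>A. card (cuts_in cuts i T)) \<le> card T"
proof -
  have "(\<Sum>i\<in>A. card (cuts_in cuts i T)) = card (\<Union>i\<in>A. cuts_in cuts i T)"
    using assms by (intro card_UN_disjoint[symmetric]) (auto simp: cuts_in_def)
  also have "\<dots> \<le> card T"
    using assms by (intro card_mono) (auto simp: cuts_in_def)
  finally show ?thesis .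
qed

section \<open>Reduce-Fastest(1) with reciprocal integer rates\<close>

locale periodic_run =
  fixes n :: nat and p :: "nat \<Rightarrow> nat" and cuts :: "nat \<Rightarrow> nat option"
  assumes p_pos: "\<And>i. p i > 0"
    and run: "reduce_fastest 1 n (\<lambda>i. 1 / real (p i)) cuts"
begin

lemma height_eq: "height (\<lambda>i. 1 / real (p i)) cuts t i = real (age cuts i t) / real (p i)"
  by (induction t) (auto simp: add_divide_distrib)

lemma grown_height_eq:
  "grown_height (\<lambda>i. 1 / real (p i)) cuts t i = real (Suc (age cuts i t)) / real (p i)"
  by (simp add: grown_height_def height_eq add_divide_distrib)

lemma tall_iff: "grown_height (\<lambda>i. 1 / real (p i)) cuts t i \<ge> 1 \<longleftrightarrow> p i \<le> Suc (age cuts i t)"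
  using p_pos[of i] unfolding grown_height_eq by (simp add: le_divide_eq del: of_nat_Suc)

lemma rate_le_iff: "1 / real (p i) \<le> 1 / real (p j) \<longleftrightarrow> p j \<le> p i"
  using p_pos[of i] p_pos[of j] by (simp add: field_simps)

lemma step:
  "case cuts t of
     None \<Rightarrow> \<forall>i\<in>{1..n}. \<not> p i \<le> Suc (age cuts i t)
   | Some j \<Rightarrow> j \<in> {1..n} \<and> p j \<le> Suc (age cuts j t) \<and>
       (\<forall>i\<in>{1..n}. p i \<le> Suc (age cuts i t) \<longrightarrow> p j \<le> p i)"
  using run
  unfolding reduce_fastest_def not_le[symmetric, of _ "1 :: real"] tall_iff rate_le_iff
  by blast

lemma cut_tall: "cuts t = Some i \<Longrightarrow> p i \<le> Suc (age cuts i t)"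
  using step[of t] by simp

lemma tall_cut:
  assumes "i \<in> {1..n}" "p i \<le> Suc (age cuts i t)"
  obtains j where "cuts t = Some j" "j \<in> {1..n}" "p j \<le> p i"
  using step[of t] assms by (cases "cuts t") auto

lemma cuts_far_apart:
  assumes "cuts s = Some j" "cuts s' = Some j" "s < s'"
  shows "p j \<le> s' - s"
  using cut_tall[OF assms(2)] age_after_cut[of cuts s j s'] assms by linarith

text \<open>
  A bamboo that is ready but not cut loses its turn to another bamboo of at least its own rate,
  and within \<open>D\<close> steps each of these is cut at most once.
\<close>

lemma age_less:
  assumes "F \<subseteq> {1..n}" "i \<in> F" "card F \<le> D"
    and upper: "\<And>j. j \<in> {1..n} \<Longrightarrow> p j \<le> p i \<Longrightarrow> j \<in> F"
    and slow: "\<And>j. j \<in> F \<Longrightarrow> D \<le> p j"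
  shows "age cuts i t < p i + D"
proof (rule ccontr)
  assume "\<not> age cuts i t < p i + D"
  then have old: "p i + D \<le> age cuts i t" by simp
  have fin: "finite F"
    using assms(1) finite_subset by blast
  have "\<exists>j\<in>F - {i}. cuts (t - Suc d) = Some j" if d: "d < D" for d
  proof -
    have "d < age cuts i t"
      using d old by linarith
    from age_uncut[OF this] have nc: "cuts (t - Suc d) \<noteq> Some i"
      and "age cuts i (t - Suc d) = age cuts i t - Suc d" by auto
    then have "p i \<le> Suc (age cuts i (t - Suc d))"
      using d old by linarith
    moreover have "i \<in> {1..n}"
      using assms by blast
    ultimately obtain j where "cuts (t - Suc d) = Some j" "j \<in> {1..n}" "p j \<le> p i"
      using tall_cut by blast
    then show ?thesis
      using nc upper by blast
  qed
  then obtain g where g: "\<And>d. d < D \<Longrightarrow> g d \<in> F - {i} \<and> cuts (t - Suc d) = Some (g d)"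
    by metis
  have "card (F - {i}) < card {..<D}"
    using assms fin card_gt_0_iff[of F] by (auto simp: card_Diff_singleton)
  moreover have "g ` {..<D} \<subseteq> F - {i}"
    using g by blast
  ultimately have "\<not> inj_on g {..<D}"
    using fin by (meson card_inj_on_le finite_Diff not_less)
  then obtain d e where de: "d < D" "e < D" "g d = g e" "d < e"
    unfolding inj_on_def by (metis lessThan_iff linorder_neqE_nat)
  have "D \<le> t"
    using old age_le[of cuts i t] by linarith
  then have "t - Suc e < t - Suc d" "(t - Suc d) - (t - Suc e) < D"
    using de by linarith+
  moreover have "p (g d) \<le> (t - Suc d) - (t - Suc e)"
    using cuts_far_apart[of "t - Suc e" "g d" "t - Suc d"] g de calculation(1) by simp
  moreover have "D \<le> p (g d)"
    using slow g de by blast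
  ultimately show False by linarith
qed

text \<open>Each cut ends a wait of at least \<open>p i\<close> steps, the first wait included
  because the start counts as a cut; \<open>age\<close> is the unfinished wait.\<close>

lemma cuts_upper: "card (cuts_in cuts i {..<t}) * p i + age cuts i t \<le> t"
proof (induction t)
  case 0
  then show ?case by (simp add: cuts_in_def)
next
  case (Suc t)
  then show ?case
    using cut_tall[of t i] by (auto simp: card_cuts_in_Suc)
qed

lemma cuts_less:
  assumes "t < k * p i"
  shows "card (cuts_in cuts i {..<t}) < k"
proof (rule ccontr)
  assume "\<not> ?thesis"
  then have "k * p i \<le> card (cuts_in cuts i {..<t}) * p i"
    by simp
  then show False
    using cuts_upper[of i t] assms by linarith
qed

text \<open>The same division of time into waits, each now of at most \<open>q\<close>
  steps.\<close>

lemma cuts_lower: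
  assumes "\<And>t. age cuts i t < q"
  shows "t \<le> card (cuts_in cuts i {..<t}) * q + age cuts i t"
proof (induction t)
  case 0
  then show ?case by simp
next
  case (Suc t)
  then show ?case
    using assms[of t] by (auto simp: card_cuts_in_Suc)
qed

lemma cuts_ge:
  assumes "\<And>t. age cuts i t < q" "k * q \<le> t"
  shows "k \<le> card (cuts_in cuts i {..<t})"
proof (rule ccontr)
  assume "\<not> ?thesis"
  then have "Suc (card (cuts_in cuts i {..<t})) * q \<le> k * q"
    by (intro mult_right_mono) auto
  then show False
    using cuts_lower[of i q t] assms(1)[of t] assms(1,2) by (auto)
qed

end

section \<open>The instance and the cuts of its fast bamboos\<close>

text \<open>
  The subtracted 300 absorbs the delays (at most 150 per cut), so that the third cut of the
  fastest bamboos still precedes step \<open>2P\<close>.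
\<close>

definition period :: "nat \<Rightarrow> nat \<Rightarrow> nat" where
  "period N i =
     (if i \<le> 50 then 400 * N - 300 else if i \<le> 100 then 465 * N else if i \<le> 150 then 507 * N
      else if i \<le> 600 * N - 50 then 600 * N else 600 * N + 1)"

lemma period_last: "150 < i \<Longrightarrow> 600 * N - 50 < i \<Longrightarrow> period N i = 600 * N + 1"
  by (simp add: period_def)

locale slow_and_fast = periodic_run "600 * N - 49" "period N" cuts
  for N :: nat and cuts :: "nat \<Rightarrow> nat option" +
  assumes N: "N \<ge> 1000"
begin

text \<open>Only the 150 triple members have periods this small, so only they can delay one another,
  whatever \<open>N\<close> is.\<close>

lemma fast_age:
  assumes "i \<in> {1..150}"
  shows "age cuts i t < period N i + 150"
proof (rule age_less[of "{1..150}"])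
  show "{1..150} \<subseteq> {1..600 * N - 49}"
    using N by auto
  show "j \<in> {1..150}" if "j \<in> {1..600 * N - 49}" "period N j \<le> period N i" for j
    using that assms N by (auto simp: period_def split: if_splits)
  show "150 \<le> period N j" if "j \<in> {1..150}" for j
    using that N by (auto simp: period_def)
qed (use assms in auto)

lemma fast_window_ge:
  assumes "i \<in> {1..150}" "w \<le> t" "w < a * period N i" "b * (period N i + 150) \<le> t"
  shows "Suc b - a \<le> card (cuts_in cuts i {w..<t})"
  using cuts_less[OF assms(3)] cuts_ge[OF fast_age[OF assms(1)] assms(4)]
  by (simp add: card_cuts_in_window[OF assms(2)])

text \<open>
  Here \<open>a - 1\<close> and \<open>a + x - 1\<close> bound the numbers of cuts of a fastest bamboo before \<open>w\<close> and
  before \<open>t\<close>; likewise for the other two periods.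
\<close>

lemma fast_window_sum:
  assumes "w \<le> t" "x + y + z = 4"
    and "w < a * (400 * N - 300)" "(a + x - 1) * (400 * N - 150) \<le> t" "a > 0"
    and "w < b * (465 * N)" "(b + y - 1) * (465 * N + 150) \<le> t" "b > 0"
    and "w < c * (507 * N)" "(c + z - 1) * (507 * N + 150) \<le> t" "c > 0"
  shows "200 \<le> (\<Sum>i\<in>{1..150}. card (cuts_in cuts i {w..<t}))"
proof -
  let ?f = "\<lambda>i. card (cuts_in cuts i {w..<t})"
  have N': "400 * N - 300 + 150 = 400 * N - 150"
    using N by simp
  have "x \<le> ?f i" if "i \<in> {1..50}" for i
    using fast_window_ge[of i w t a "a + x - 1"] that assms N' by (auto simp: period_def)
  then have "50 * x \<le> sum ?f {1..50}"
    using sum_bounded_below[of "{1..50}" x ?f] by simp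
  moreover have "y \<le> ?f i" if "i \<in> {51..100}" for i
    using fast_window_ge[of i w t b "b + y - 1"] that assms by (auto simp: period_def)
  then have "50 * y \<le> sum ?f {51..100}"
    using sum_bounded_below[of "{51..100}" y ?f] by simp
  moreover have "z \<le> ?f i" if "i \<in> {101..150}" for i
    using fast_window_ge[of i w t c "c + z - 1"] that assms by (auto simp: period_def)
  then have "50 * z \<le> sum ?f {101..150}"
    using sum_bounded_below[of "{101..150}" z ?f] by simp
  moreover have "sum ?f {1..150} = sum ?f {1..50} + sum ?f {51..100} + sum ?f {101..150}"
  proof -
    have "{1..150} = {1..50} \<union> {51..100} \<union> {101..150::nat}" by auto
    then show ?thesis
      by (simp only:) (subst sum.union_disjoint; auto)+
  qed
  ultimately show ?thesis
    using assms(2) by linarith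
qed

text \<open>As \<open>w\<close> passes \<open>800 * N - 600\<close>, \<open>930 * N\<close> and
  \<open>1014 * N\<close>, the second cut of the first, second and third group in turn may drop out
  of the window. By then \<open>t\<close> is late enough to guarantee a replacement: the third cut
  of the second group, the third of the third group, and the fourth of the first.\<close>

lemma fast_window:
  assumes "w \<le> t" "600 * N - 1 \<le> w" "w < 3 * (400 * N - 300)" "1200 * N - 201 \<le> t"
    "w + 600 * N - 1 \<le> t \<or> w = 600 * N - 1"
  shows "200 \<le> (\<Sum>i\<in>{1..150}. card (cuts_in cuts i {w..<t}))"
proof -
  have far: "w + 600 * N - 1 \<le> t" if "700 * N \<le> w"
    using assms(5) that N by linarith
  consider "w < 2 * (400 * N - 300)" | "2 * (400 * N - 300) \<le> w" "w < 930 * N"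
    | "930 * N \<le> w" "w < 1014 * N" | "1014 * N \<le> w"
    by linarith
  then show ?thesis
  proof cases
    case 1
    then show ?thesis
      using fast_window_sum[of w t 2 1 1 2 2 2] assms N by simp
  next
    case 2
    then have "1395 * N + 450 \<le> t"
      using far N by linarith
    then show ?thesis
      using fast_window_sum[of w t 1 2 1 3 2 2] 2 assms N by simp
  next
    case 3
    then have "1521 * N + 450 \<le> t"
      using far N by linarith
    then show ?thesis
      using fast_window_sum[of w t 1 1 2 3 3 2] 3 assms N by simp
  next
    case 4
    then have "1521 * N + 450 \<le> t" "4 * (400 * N - 150) \<le> t" "w < 1395 * N"
      using far assms(3) N by linarith+
    then show ?thesis
      using fast_window_sum[of w t 2 1 1 3 3 3] assms N by simp
  qed
qed

section \<open>Survival of the last bamboo\<close>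

text \<open>Otherwise the window would hold \<open>600 * N\<close> cuts in at most
  \<open>600 * N - 1\<close> steps. The upper bound on \<open>t\<close> is the largest for which the
  window starts before \<open>3 * (400 * N - 300)\<close>.\<close>

lemma slow_ready:
  assumes "600 * N - 1 \<le> t" "t \<le> 1800 * N - 902"
  shows "\<exists>i\<in>{151..600 * N - 50}. period N i \<le> Suc (age cuts i t)"
proof (rule ccontr)
  let ?S = "{151..600 * N - 50}"
  \<comment> \<open>The window can be truncated at \<open>600 * N - 1\<close> because no slow bamboo
    is ready before that step.\<close>
  define w where "w = max (t + 1 - 600 * N) (600 * N - 1)"
  assume none: "\<not> (\<exists>i\<in>?S. period N i \<le> Suc (age cuts i t))"
  have "1 \<le> card (cuts_in cuts i {w..<t})" if i: "i \<in> ?S" for i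
  proof -
    have pi: "period N i = 600 * N"
      using i by (simp add: period_def)
    then have young: "Suc (age cuts i t) < 600 * N"
      using none i by force
    then have "age cuts i t < t"
      using assms by linarith
    then obtain s where s: "s < t" "cuts s = Some i" "age cuts i t = t - Suc s"
      using recent_cut by blast
    have "600 * N \<le> Suc s"
      using cut_tall[OF s(2)] pi age_le[of cuts i s] by linarith
    then have "s \<in> cuts_in cuts i {w..<t}"
      using s young by (auto simp: cuts_in_def w_def)
    then show ?thesis
      using card_gt_0_iff[of "cuts_in cuts i {w..<t}"] by (auto simp: cuts_in_def)
  qed
  then have slow: "600 * N - 200 \<le> (\<Sum>i\<in>?S. card (cuts_in cuts i {w..<t}))"
    using sum_bounded_below[of ?S 1 "\<lambda>i. card (cuts_in cuts i {w..<t})"] by simp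
  have "(\<Sum>i\<in>{1..150} \<union> ?S. card (cuts_in cuts i {w..<t})) \<le> card {w..<t}"
    by (intro sum_card_cuts_in_le) auto
  then have total: "(\<Sum>i\<in>{1..150}. card (cuts_in cuts i {w..<t})) +
      (\<Sum>i\<in>?S. card (cuts_in cuts i {w..<t})) \<le> t - w"
    by (subst (asm) sum.union_disjoint) auto
  have w: "w \<le> t" "t - w \<le> 600 * N - 1" "600 * N - 1 \<le> w"
    using assms N by (auto simp: w_def)
  \<comment> \<open>The slow cuts alone occupy \<open>600 * N - 200\<close> steps from
    \<open>600 * N - 1\<close> on, which excludes early \<open>t\<close> with a short truncated
    window.\<close>
  then have "1200 * N - 201 \<le> t"
    using slow total N by linarith
  moreover have "w + 600 * N - 1 \<le> t \<or> w = 600 * N - 1"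
    using assms N by (auto simp: w_def max_def)
  moreover have "w < 3 * (400 * N - 300)"
    using assms N by (auto simp: w_def)
  ultimately have "200 \<le> (\<Sum>i\<in>{1..150}. card (cuts_in cuts i {w..<t}))"
    using w fast_window by blast
  then show False
    using slow total w N by linarith
qed

text \<open>The extra 1 in the last period excludes ties: a ready slow bamboo is strictly faster and
  takes precedence.\<close>

lemma last_age:
  assumes "t \<le> 1800 * N - 901"
  shows "age cuts (600 * N - 49) t = t"
  using assms
proof (induction t)
  case 0
  then show ?case by simp
next
  case (Suc t)
  have "cuts t \<noteq> Some (600 * N - 49)"
  proof
    assume cut: "cuts t = Some (600 * N - 49)"
    have last: "period N (600 * N - 49) = 600 * N + 1"
      using N by (intro period_last) linarith+
    have "600 * N \<le> t"
      using cut_tall[OF cut] last Suc by simp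
    moreover have "t \<le> 1800 * N - 902"
      using Suc.prems by linarith
    ultimately obtain i where i: "i \<in> {151..600 * N - 50}" "period N i \<le> Suc (age cuts i t)"
      using slow_ready[of t] by (meson diff_le_self le_trans)
    have "i \<in> {1..600 * N - 49}" "period N i = 600 * N"
      using i by (auto simp: period_def)
    then obtain j where "cuts t = Some j" "period N j \<le> 600 * N"
      using tall_cut[of i t] i by metis
    then show False
      using cut last by simp
  qed
  then show ?case
    using Suc by simp
qed

end

section \<open>Total rate and choice of \<open>N\<close>\<close>

lemma sum_rates:
  assumes N: "N \<ge> 1000"
  shows "(\<Sum>i\<in>{1..600 * N - 49}. 1 / real (period N i)) \<le> 1"
proof -
  let ?r = "\<lambda>i. 1 / real (period N i)"
  have split: "{1..600 * N - 49} = {1..50} \<union> {51..100} \<union> {101..150} \<union> {151..600 * N - 50} \<union> {600 * N - 49}"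
    using N by auto
  have "sum ?r {1..600 * N - 49} =
    sum ?r {1..50} + sum ?r {51..100} + sum ?r {101..150} + sum ?r {151..600 * N - 50} + ?r (600 * N - 49)"
    unfolding split using N by (subst sum.union_disjoint; auto)+
  also have "sum ?r {1..50} = 50 / (400 * real N - 300)"
    using N by (simp add: period_def of_nat_diff)
  also have "sum ?r {51..100} = 50 / (465 * real N)"
    by (simp add: period_def)
  also have "sum ?r {101..150} = 50 / (507 * real N)"
    by (simp add: period_def)
  also have "sum ?r {151..600 * N - 50} = (600 * real N - 200) / (600 * real N)"
    using N by (simp add: period_def of_nat_diff)
  also have "period N (600 * N - 49) = 600 * N + 1"
    using N by (intro period_last) linarith+
  also have "1 / real (600 * N + 1) = 1 / (600 * real N + 1)"
    by simp
  also have "50 / (400 * real N - 300) + 50 / (465 * real N) + 50 / (507 * real N)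
      + (600 * real N - 200) / (600 * real N) + 1 / (600 * real N + 1) \<le> 1"
  proof -
    have N': "real N \<ge> 1000" using N by simp
    \<comment> \<open>\<open>1001 / 8000\<close> is \<open>1 / 8\<close> enlarged to absorb the
      \<open>- 300\<close>; \<open>1 / 3\<close> is the share freed by having only
      \<open>600 * N - 200\<close> slow bamboos.\<close>
    have "50 / (400 * real N - 300) \<le> (1001 / 8000) / real N"
      "50 / (465 * real N) = (10 / 93) / real N"
      "50 / (507 * real N) = (50 / 507) / real N"
      "(600 * real N - 200) / (600 * real N) = 1 - (1 / 3) / real N"
      "1 / (600 * real N + 1) \<le> (1 / 600) / real N"
      using N' by (auto simp: field_simps)
    moreover have "(1001 / 8000) / real N + (10 / 93) / real N + (50 / 507) / real N + (1 / 600) / real N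
        \<le> (1 / 3) / real N"
      using N' by (simp add: field_simps)
    ultimately show ?thesis by linarith
  qed
  finally show ?thesis .
qed

theorem theorem3p3:
  fixes c :: real
  assumes "c < 3"
  shows "\<exists>(n::nat) (h :: nat \<Rightarrow> real).
           (\<forall>i\<in>{1..n}. h i > 0) \<and> (\<Sum>i\<in>{1..n}. h i) \<le> 1 \<and>
           (\<forall>cuts. reduce_fastest 1 n h cuts \<longrightarrow>
              (\<exists>t. \<exists>i\<in>{1..n}. grown_height h cuts t i > c))"
proof -
  \<comment> \<open>The final height \<open>(1800 * N - 900) / (600 * N + 1)\<close> exceeds
    \<open>c\<close> iff \<open>600 * (3 - c) * N > 900 + c\<close>, and
    \<open>900 + c < 904\<close>.\<close>
  obtain N0 :: nat where N0: "904 / (600 * (3 - c)) < real N0"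
    using reals_Archimedean2 by blast
  define N where "N = N0 + 1000"
  have N: "N \<ge> 1000" and "904 / (600 * (3 - c)) < real N"
    using N0 by (auto simp: N_def)
  then have big: "904 < 600 * (3 - c) * real N"
    using assms by (simp add: field_simps)
  let ?n = "600 * N - 49" and ?h = "\<lambda>i. 1 / real (period N i)"
  have pos: "period N i > 0" for i
    using N by (auto simp: period_def)
  have "\<exists>t. \<exists>i\<in>{1..?n}. grown_height ?h cuts t i > c" if "reduce_fastest 1 ?n ?h cuts" for cuts
  proof -
    interpret slow_and_fast N cuts
      by unfold_locales (use that N pos in auto)
    have "grown_height ?h cuts (1800 * N - 901) ?n = real (1800 * N - 900) / real (600 * N + 1)"
      unfolding grown_height_eq using N period_last[of ?n N] by (simp add: last_age Suc_diff_le)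
    also have "\<dots> > c"
      using N big assms by (simp add: of_nat_diff field_simps)
    finally show ?thesis
      using N by (intro exI[of _ "1800 * N - 901"] bexI[of _ ?n]) auto
  qed
  then show ?thesis
    using pos sum_rates[OF N] by (intro exI[of _ ?n] exI[of _ ?h]) auto
qed

end
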